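(* Let $0<\alpha<1$ and consider, for $\lambda>0$, the problem $$u''+\lambda h(x,\alpha)e^u=0,\quad x\in(-1,1),\qquad u(-1)=u(1)=0. \quad (\ast)$$ For each $\beta>0$, there exists a unique pair $(\lambda,u)$ such that $\lambda>0$ and $u$ is a positive even solution of $(\ast)$ with $\|u\|_\infty=\beta$, namely $(\lambda,u)=(\Lambda(\beta),U(\,\cdot\,;\beta))$. Moreover, letting $\beta_1$ be the unique positive root of $\sqrt{1-e^{-\beta}}\,\operatorname{arctanh}\sqrt{1-e^{-\beta}}=1$ and $\lambda_1=\Lambda(\beta_1)$, the following hold: (i) if $0<\lambda<\lambda_1$, then $(\ast)$ has exactly two positive even solutions; (ii) if $\lambda=\lambda_1$, then $(\ast)$ has a unique positive even solution; (iii) if $\lambda>\lambda_1$, then $(\ast)$ has no positive even solution.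
   Context: Fix $0<\alpha<1$. Let $h(x,\alpha)=0$ for $|x|<\alpha$ and $h(x,\alpha)=1$ for $\alpha\le|x|\le1$. A solution of $(\ast)$ is a function $u\in C^2([-1,1]\setminus\{-\alpha,\alpha\})\cap C^1[-1,1]$ with $u(\pm1)=0$ satisfying the equation on $(-1,1)\setminus\{-\alpha,\alpha\}$. It is positive if $u>0$ on $(-1,1)$. Put $\|u\|_\infty=\sup_{x\in[-1,1]}|u(x)|$. Let $w(x)=\log(1-\tanh^2(x/\sqrt2))$, $\eta(\beta)=\sqrt2\,\operatorname{arctanh}\sqrt{1-e^{-\beta}}$ (the inverse of $x\mapsto -w(x)$ on $[0,\infty)$), and for $\beta>0$ $$\Lambda(\beta)=(1-\alpha)^{-2}e^{-\beta}[\eta(\beta)]^2,\qquad U(x;\beta)=\begin{cases}\beta,&|x|<\alpha,\\ w\!\left(\eta(\beta)\frac{|x|-\alpha}{1-\alpha}\right)+\beta,&\alpha\le|x|\le1.\end{cases}$$ *)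

theory Defs
  imports "HOL-Analysis.Analysis" "HOL-Library.FuncSet"
begin

text \<open>
  Continuous differentiability relative to a set \<open>S\<close> without isolated points. Derivatives are taken
  within \<open>S\<close>, hence are one-sided at an endpoint that belongs to \<open>S\<close>.
\<close>

definition C1_on :: "real set \<Rightarrow> (real \<Rightarrow> real) \<Rightarrow> bool" where
  "C1_on S f \<longleftrightarrow>
     (\<exists>f'. (\<forall>x\<in>S. (f has_real_derivative f' x) (at x within S)) \<and> continuous_on S f')"

definition C2_on :: "real set \<Rightarrow> (real \<Rightarrow> real) \<Rightarrow> bool" where
  "C2_on S f \<longleftrightarrow>
     (\<exists>f'. (\<forall>x\<in>S. (f has_real_derivative f' x) (at x within S)) \<and> C1_on S f')"

definition h :: "real \<Rightarrow> real \<Rightarrow> real" where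
  "h x \<alpha> = (if \<bar>x\<bar> < \<alpha> then 0 else 1)"

text \<open>
  Functions on \<open>[-1,1]\<close> are represented by \<^const>\<open>extensional\<close> functions, so that equality and
  counting of solutions depend on the values on \<open>[-1,1]\<close> only. The equation is required at interior
  points, near which \<^const>\<open>deriv\<close> does not see the values outside \<open>[-1,1]\<close>.
\<close>

definition solution :: "real \<Rightarrow> real \<Rightarrow> (real \<Rightarrow> real) \<Rightarrow> bool" where
  "solution \<alpha> lam u \<longleftrightarrow>
     u \<in> extensional {-1..1} \<and>
     C2_on ({-1..1} - {-\<alpha>, \<alpha>}) u \<and> C1_on {-1..1} u \<and>
     u (-1) = 0 \<and> u 1 = 0 \<and>
     (\<forall>x \<in> {-1<..<1} - {-\<alpha>, \<alpha>}. deriv (deriv u) x + lam * h x \<alpha> * exp (u x) = 0)"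

definition positive_even_solution :: "real \<Rightarrow> real \<Rightarrow> (real \<Rightarrow> real) \<Rightarrow> bool" where
  "positive_even_solution \<alpha> lam u \<longleftrightarrow>
     solution \<alpha> lam u \<and> (\<forall>x\<in>{-1<..<1}. u x > 0) \<and> (\<forall>x\<in>{-1..1}. u (-x) = u x)"

definition sup_norm :: "(real \<Rightarrow> real) \<Rightarrow> real" where
  "sup_norm u = (SUP x\<in>{-1..1}. \<bar>u x\<bar>)"

definition w :: "real \<Rightarrow> real" where
  "w x = ln (1 - (tanh (x / sqrt 2))\<^sup>2)"

definition \<eta> :: "real \<Rightarrow> real" where
  "\<eta> \<beta> = sqrt 2 * artanh (sqrt (1 - exp (-\<beta>)))"

definition \<Lambda> :: "real \<Rightarrow> real \<Rightarrow> real" where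
  "\<Lambda> \<alpha> \<beta> = (1 - \<alpha>) powi (-2) * exp (-\<beta>) * (\<eta> \<beta>)\<^sup>2"

definition U :: "real \<Rightarrow> real \<Rightarrow> real \<Rightarrow> real" where
  "U \<alpha> \<beta> = (\<lambda>x\<in>{-1..1}.
     if \<bar>x\<bar> < \<alpha> then \<beta> else w (\<eta> \<beta> * ((\<bar>x\<bar> - \<alpha>) / (1 - \<alpha>))) + \<beta>)"

definition turning_point :: "real \<Rightarrow> bool" where
  "turning_point \<beta> \<longleftrightarrow>
     \<beta> > 0 \<and> sqrt (1 - exp (-\<beta>)) * artanh (sqrt (1 - exp (-\<beta>))) = 1"

end

theory Submission
  imports Defs
begin

text \<open>
  An even solution is linear, hence constant, on \<open>[-\<alpha>, \<alpha>]\<close>, so on \<open>[\<alpha>, 1]\<close> it solves the Liouville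
  equation with horizontal initial slope, which determines it explicitly. Writing the maximum as
  \<open>\<beta> = 2 ln (cosh t)\<close> gives \<open>\<eta> \<beta> = sqrt 2 * t\<close>, makes \<open>\<Lambda> \<alpha> \<beta>\<close> a constant multiple of
  \<open>(t / cosh t)\<^sup>2\<close>, and turns the equation for \<open>\<beta>\<^sub>1\<close> into the critical point equation
  \<open>t * tanh t = 1\<close> of the unimodal function \<open>t / cosh t\<close>.
\<close>

section \<open>Hyperbolic parametrisation of the maximum\<close>

lemma one_minus_tanh_sq: "1 - (tanh x)\<^sup>2 = 1 / (cosh x)\<^sup>2" for x :: real
proof -
  have "1 - (tanh x)\<^sup>2 = ((cosh x)\<^sup>2 - (sinh x)\<^sup>2) / (cosh x)\<^sup>2"
    by (simp add: tanh_def power_divide diff_divide_distrib)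
  then show ?thesis by (simp add: hyperbolic_pythagoras)
qed

text \<open>This is \<open>- w\<close> with its argument rescaled by \<open>sqrt 2\<close>. On
  positive arguments it inverts \<beta> \<mapsto> \<open>\<eta> \<beta> / sqrt 2\<close>, so the
  parameter t can replace the maximum \<beta> and every \<open>artanh\<close> disappears.\<close>

definition height :: "real \<Rightarrow> real" where
  "height t = 2 * ln (cosh t)"

lemma height_0 [simp]: "height 0 = 0"
  by (simp add: height_def)

lemma w_eq_height: "w x = - height (x / sqrt 2)"
  by (simp add: w_def height_def one_minus_tanh_sq ln_div ln_realpow)

lemma exp_height: "exp (height t) = (cosh t)\<^sup>2"
  by (simp add: height_def exp_double)

lemma exp_minus_height: "exp (- height t) = 1 / (cosh t)\<^sup>2"
  by (simp add: exp_minus exp_height divide_simps)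

lemma cosh_gt_1: "t \<noteq> 0 \<Longrightarrow> cosh t > 1" for t :: real
  using cosh_real_ge_1[of t] cosh_real_one_iff[of t] by linarith

lemma height_pos: "t \<noteq> 0 \<Longrightarrow> height t > 0"
  by (simp add: height_def cosh_gt_1)

lemma sqrt_height:
  assumes "t > 0"
  shows "sqrt (1 - exp (- height t)) = tanh t"
  unfolding exp_minus_height one_minus_tanh_sq[of t, symmetric] using assms by simp

lemma eta_height: "t > 0 \<Longrightarrow> \<eta> (height t) = sqrt 2 * t"
  by (simp add: \<eta>_def sqrt_height artanh_tanh_real)

lemma turning_point_height: "t > 0 \<Longrightarrow> turning_point (height t) \<longleftrightarrow> t * tanh t = 1"
  by (simp add: turning_point_def sqrt_height artanh_tanh_real height_pos mult.commute)

lemma height_surj: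
  assumes "\<beta> > 0"
  obtains t where "t > 0" "\<beta> = height t"
proof
  have gt: "exp (\<beta> / 2) > 1" using assms by simp
  then show "arcosh (exp (\<beta> / 2)) > 0" by simp
  show "\<beta> = height (arcosh (exp (\<beta> / 2)))"
    using gt by (simp add: height_def cosh_arcosh_real)
qed

lemma height_inject: "s > 0 \<Longrightarrow> t > 0 \<Longrightarrow> height s = height t \<longleftrightarrow> s = t"
  using eta_height by (metis mult_left_cancel real_sqrt_eq_zero_cancel_iff zero_neq_numeral)

text \<open>Used for counting: for fixed \<alpha> the bifurcation curve depends on t only through
  \<open>t / cosh t\<close>, so its shape is the shape of that quotient.\<close>

lemma Lambda_height: "t > 0 \<Longrightarrow> \<Lambda> \<alpha> (height t) = 2 / (1 - \<alpha>)\<^sup>2 * (t / cosh t)\<^sup>2"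
  by (simp add: \<Lambda>_def exp_minus_height eta_height power_int_minus power_mult_distrib
      power_divide divide_simps)

section \<open>One-sided hinges and the glued profile\<close>

definition hinge :: "real \<Rightarrow> real \<Rightarrow> real" where
  "hinge m r = - height (m * max 0 r)"

lemma hinge_nonpos: "r \<le> 0 \<Longrightarrow> hinge m r = 0"
  by (simp add: hinge_def height_def)

lemma hinge_le_0: "hinge m r \<le> 0"
  by (simp add: hinge_def height_def cosh_real_ge_1)

lemma has_field_derivative_transform_on:
  assumes "x \<in> S" "\<And>y. y \<in> S \<Longrightarrow> g y = f y" "(f has_field_derivative D) (at x within S)"
  shows "(g has_field_derivative D) (at x within S)"
  using assms unfolding has_field_derivative_def by (rule has_derivative_transform)

text \<open>The punctured neighbourhood filter at x is the join of its two one-sided parts, so a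
  limit along both parts is a two-sided limit.\<close>

lemma has_real_derivative_left_right:
  fixes f :: "real \<Rightarrow> real"
  assumes "(f has_real_derivative D) (at x within {..x})"
      and "(f has_real_derivative D) (at x within {x..})"
  shows "(f has_real_derivative D) (at x)"
proof -
  have "{..x} \<union> {x..} = UNIV" by auto
  then have "at x = sup (at x within {..x}) (at x within {x..})"
    by (metis at_within_union)
  then show ?thesis using assms
    unfolding has_field_derivative_iff by (simp add: filterlim_sup)
qed

lemma height_scaled_deriv:
  "((\<lambda>r. height (m * r)) has_real_derivative 2 * m * tanh (m * r)) (at r within S)"
proof -
  have "cosh (m * r) > 0" by simp
  then show ?thesis unfolding height_def
    by (auto intro!: derivative_eq_intros simp: tanh_def field_simps)
qed

text \<open>The corner at 0 stays differentiable because \<open>tanh\<close> vanishes there: both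
  one-sided derivatives are 0. Keeping \<open>max 0 r\<close> inside \<open>tanh\<close> gives one
  continuous formula for flat and curved parts alike.\<close>

lemma hinge_deriv:
  "(hinge m has_real_derivative (- 2 * m * tanh (m * max 0 r))) (at r)"
proof -
  have L: "(hinge m has_real_derivative 0) (at r within {..0})" if "r \<le> 0"
    by (rule has_field_derivative_transform_on[of _ _ _ "\<lambda>_. 0"]) (use that in \<open>auto simp: hinge_nonpos\<close>)
  have R: "(hinge m has_real_derivative (- 2 * m * tanh (m * r))) (at r within {0..})" if "r \<ge> 0"
  proof (rule has_field_derivative_transform_on)
    show "((\<lambda>r. - height (m * r)) has_real_derivative - 2 * m * tanh (m * r)) (at r within {0..})"
      using DERIV_minus[OF height_scaled_deriv] by simp
  qed (use that in \<open>auto simp: hinge_def\<close>)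
  consider "r < 0" | "r = 0" | "r > 0" by linarith
  then show ?thesis
  proof cases
    case 1
    then show ?thesis using L at_within_interior[of r "{..0}"] by simp
  next
    case 2
    then show ?thesis using L R by (intro has_real_derivative_left_right) auto
  next
    case 3
    then show ?thesis using R at_within_interior[of r "{0..}"] by simp
  qed
qed

text \<open>The second derivative jumps at 0 from 0 to \<open>- 2 * m\<^sup>2\<close>, hence the
  exclusion of the corner. On the curved side, 1 - tanh^2 = 1 / cosh^2 is exactly the exponential of
  the hinge, which is the Liouville equation.\<close>

lemma hinge_deriv2:
  assumes "r \<noteq> 0"
  shows "((\<lambda>r. - 2 * m * tanh (m * max 0 r)) has_real_derivative
           (if r < 0 then 0 else - 2 * m\<^sup>2 * exp (hinge m r))) (at r)"
proof (cases "r < 0")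
  case True
  have "((\<lambda>r. - 2 * m * tanh (m * max 0 r)) has_real_derivative 0) (at r)"
    by (rule has_field_derivative_transform_within_open[of "\<lambda>_. 0" _ _ "{..<0}"]) (use True in auto)
  then show ?thesis using True by simp
next
  case False
  have "((\<lambda>r. - 2 * m * tanh (m * r)) has_real_derivative - 2 * m\<^sup>2 * (1 - (tanh (m * r))\<^sup>2)) (at r)"
    by (auto intro!: derivative_eq_intros simp: power2_eq_square)
  then have "((\<lambda>r. - 2 * m * tanh (m * max 0 r)) has_real_derivative - 2 * m\<^sup>2 * (1 - (tanh (m * r))\<^sup>2)) (at r)"
    by (rule has_field_derivative_transform_within_open[of _ _ _ "{0<..}"]) (use False assms in auto)
  then show ?thesis using False
    by (simp add: hinge_def exp_minus_height one_minus_tanh_sq)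
qed

text \<open>Since \<^const>\<open>hinge\<close> vanishes on the negative axis, adding its two translates glues the flat
  piece to both wings at once, and smoothness of \<^const>\<open>U\<close> only has to be checked at one corner.\<close>

definition profile :: "real \<Rightarrow> real \<Rightarrow> real \<Rightarrow> real \<Rightarrow> real" where
  "profile \<alpha> m \<beta> x = \<beta> + hinge m (x - \<alpha>) + hinge m (- x - \<alpha>)"

lemma U_eq_profile:
  assumes "0 < \<alpha>" "\<alpha> < 1" "t > 0" "x \<in> {-1..1}"
  shows "U \<alpha> (height t) x = profile \<alpha> (t / (1 - \<alpha>)) (height t) x"
proof -
  consider "\<bar>x\<bar> < \<alpha>" | "x \<ge> \<alpha>" | "x \<le> - \<alpha>" using assms by linarith
  then show ?thesis
  proof cases
    case 1
    then show ?thesis using assms by (simp add: U_def profile_def hinge_nonpos)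
  qed (use assms in \<open>auto simp: U_def profile_def hinge_def w_eq_height eta_height\<close>)
qed

definition profile' :: "real \<Rightarrow> real \<Rightarrow> real \<Rightarrow> real" where
  "profile' \<alpha> m x = - 2 * m * tanh (m * max 0 (x - \<alpha>)) + 2 * m * tanh (m * max 0 (- x - \<alpha>))"

lemma profile_deriv: "(profile \<alpha> m \<beta> has_real_derivative profile' \<alpha> m x) (at x within S)"
proof -
  have R: "((\<lambda>x. x - \<alpha>) has_real_derivative 1) (at x)"
    and L: "((\<lambda>x. - x - \<alpha>) has_real_derivative - 1) (at x)"
    by (auto intro!: derivative_eq_intros)
  have "(profile \<alpha> m \<beta> has_real_derivative profile' \<alpha> m x) (at x)"
    using DERIV_add[OF DERIV_add[OF DERIV_const[of \<beta>] DERIV_chain2[OF hinge_deriv[of m] R]]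
        DERIV_chain2[OF hinge_deriv[of m] L]]
    by (simp add: profile_def[abs_def] profile'_def)
  then show ?thesis by (rule has_field_derivative_at_within)
qed

lemma profile'_continuous: "continuous_on S (profile' \<alpha> m)"
  unfolding profile'_def by (auto intro!: continuous_intros simp: cosh_real_nonzero)

text \<open>As \<alpha> > 0, at most one hinge is active at any point. Where one is,
  \<open>exp (profile \<alpha> m \<beta> x)\<close> is the exponential of that hinge times
  \<open>exp \<beta>\<close>; compensating this factor puts \<open>exp (- \<beta>)\<close> into the
  coefficient.\<close>

lemma profile'_deriv:
  assumes "\<bar>x\<bar> \<noteq> \<alpha>" "\<alpha> > 0"
  shows "(profile' \<alpha> m has_real_derivative - (2 * m\<^sup>2 * exp (- \<beta>)) * h x \<alpha> * exp (profile \<alpha> m \<beta> x))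
           (at x within S)"
proof -
  let ?d = "\<lambda>r. if r < 0 then 0 else - 2 * m\<^sup>2 * exp (hinge m r)"
  have R: "((\<lambda>x. x - \<alpha>) has_real_derivative 1) (at x)"
    and L: "((\<lambda>x. - x - \<alpha>) has_real_derivative - 1) (at x)"
    by (auto intro!: derivative_eq_intros)
  have ne: "x - \<alpha> \<noteq> 0" "- x - \<alpha> \<noteq> 0" using assms by auto
  have "(profile' \<alpha> m has_real_derivative ?d (x - \<alpha>) + ?d (- x - \<alpha>)) (at x)"
    using DERIV_diff[OF DERIV_chain2[OF hinge_deriv2[OF ne(1), of m] R]
        DERIV_chain2[OF hinge_deriv2[OF ne(2), of m] L]]
    unfolding profile'_def[abs_def] by simp
  moreover have "?d (x - \<alpha>) + ?d (- x - \<alpha>)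
      = - (2 * m\<^sup>2 * exp (- \<beta>)) * h x \<alpha> * exp (profile \<alpha> m \<beta> x)"
  proof -
    consider "\<bar>x\<bar> < \<alpha>" | "x > \<alpha>" | "x < - \<alpha>" using assms by linarith
    then show ?thesis using assms(2)
      by cases (auto simp: h_def profile_def hinge_nonpos exp_add exp_minus)
  qed
  ultimately have "(profile' \<alpha> m has_real_derivative
      - (2 * m\<^sup>2 * exp (- \<beta>)) * h x \<alpha> * exp (profile \<alpha> m \<beta> x)) (at x)"
    by simp
  then show ?thesis by (rule has_field_derivative_at_within)
qed

section \<open>The functions \<open>U\<close> solve the problem\<close>

lemma h_continuous: "0 < \<alpha> \<Longrightarrow> continuous_on (S - {-\<alpha>, \<alpha>}) (\<lambda>x. h x \<alpha>)"
proof -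
  assume "0 < \<alpha>"
  have "continuous_on ({x. \<bar>x\<bar> < \<alpha>} \<union> {x. \<bar>x\<bar> > \<alpha>}) (\<lambda>x. h x \<alpha>)"
  proof (rule continuous_on_open_Un)
    show "open {x::real. \<bar>x\<bar> < \<alpha>}" "open {x::real. \<bar>x\<bar> > \<alpha>}"
      by (auto intro!: open_Collect_less continuous_intros)
    show "continuous_on {x. \<bar>x\<bar> < \<alpha>} (\<lambda>x. h x \<alpha>)"
      by (rule continuous_on_eq[of _ "\<lambda>_. 0"]) (auto simp: h_def)
    show "continuous_on {x. \<bar>x\<bar> > \<alpha>} (\<lambda>x. h x \<alpha>)"
      by (rule continuous_on_eq[of _ "\<lambda>_. 1"]) (auto simp: h_def)
  qed
  then show ?thesis by (rule continuous_on_subset) auto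
qed

text \<open>The value of \<Lambda> in the shape of the coefficient in \<open>profile'_deriv\<close>,
  with m = t / (1 - \<alpha>).\<close>

lemma Lambda_height':
  assumes "\<alpha> < 1" "t > 0"
  shows "\<Lambda> \<alpha> (height t) = 2 * (t / (1 - \<alpha>))\<^sup>2 * exp (- height t)"
  using assms by (simp add: Lambda_height exp_minus_height power_divide)

lemma U_solution:
  assumes "0 < \<alpha>" "\<alpha> < 1" "t > 0"
  shows "positive_even_solution \<alpha> (\<Lambda> \<alpha> (height t)) (U \<alpha> (height t))"
proof -
  define m \<beta> where "m = t / (1 - \<alpha>)" and "\<beta> = height t"
  let ?S = "{-1..1} - {-\<alpha>, \<alpha>}"
  define lam where "lam = \<Lambda> \<alpha> \<beta>"
  have lam: "lam = 2 * m\<^sup>2 * exp (- \<beta>)"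
    using assms by (simp add: lam_def m_def \<beta>_def Lambda_height')
  have eq: "U \<alpha> \<beta> x = profile \<alpha> m \<beta> x" if "x \<in> {-1..1}" for x
    using U_eq_profile assms that by (simp add: m_def \<beta>_def)
  have d1: "(U \<alpha> \<beta> has_real_derivative profile' \<alpha> m x) (at x within S)"
    if "x \<in> S" "S \<subseteq> {-1..1}" for x S
    by (rule has_field_derivative_transform_on[OF _ _ profile_deriv]) (use that eq in auto)
  have d2: "(profile' \<alpha> m has_real_derivative - lam * h x \<alpha> * exp (profile \<alpha> m \<beta> x)) (at x within S)"
    if "x \<notin> {-\<alpha>, \<alpha>}" for x S
    unfolding lam using that assms by (intro profile'_deriv) auto
  have c: "continuous_on ?S (\<lambda>x. - lam * h x \<alpha> * exp (profile \<alpha> m \<beta> x))"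
    using assms DERIV_continuous_on[OF profile_deriv]
    by (intro continuous_intros h_continuous) auto
  have C2: "C2_on ?S (U \<alpha> \<beta>)"
    unfolding C2_on_def C1_on_def
  proof (intro exI conjI ballI)
    show "(U \<alpha> \<beta> has_real_derivative profile' \<alpha> m x) (at x within ?S)" if "x \<in> ?S" for x
      using that by (intro d1) auto
    show "(profile' \<alpha> m has_real_derivative - lam * h x \<alpha> * exp (profile \<alpha> m \<beta> x)) (at x within ?S)"
      if "x \<in> ?S" for x
      using that by (intro d2) auto
  qed (rule c)
  have C1: "C1_on {-1..1} (U \<alpha> \<beta>)"
    unfolding C1_on_def using d1 profile'_continuous by blast
  have ode: "deriv (deriv (U \<alpha> \<beta>)) x + lam * h x \<alpha> * exp (U \<alpha> \<beta> x) = 0"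
    if x: "x \<in> {-1<..<1} - {-\<alpha>, \<alpha>}" for x
  proof -
    \<comment> \<open>The function \<open>deriv\<close> is two-sided, so it is identified on the
      open interval, which is a neighbourhood of x; this suffices to differentiate once
      more.\<close>
    have "deriv (U \<alpha> \<beta>) y = profile' \<alpha> m y" if "y \<in> {-1<..<1}" for y
      using d1[of y "{-1..1}"] that
      by (intro DERIV_imp_deriv) (simp add: at_within_Icc_at)
    then have "(deriv (U \<alpha> \<beta>) has_real_derivative - lam * h x \<alpha> * exp (profile \<alpha> m \<beta> x)) (at x)"
      using x by (intro has_field_derivative_transform_within_open[OF d2[of x UNIV], of "{-1<..<1}"]) auto
    then show ?thesis using eq[of x] x by (simp add: DERIV_imp_deriv)
  qed
  \<comment> \<open>This choice of m makes the active hinge equal to \<open>- height t\<close> at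
    each endpoint, cancelling \<beta> there.\<close>
  have m1: "m * (1 - \<alpha>) = t" using assms by (simp add: m_def)
  have mpos: "m > 0" using assms by (simp add: m_def)
  have bd: "U \<alpha> \<beta> (-1) = 0" "U \<alpha> \<beta> 1 = 0"
    using assms m1 by (simp_all add: eq) (simp_all add: profile_def hinge_def \<beta>_def)
  have even: "U \<alpha> \<beta> (-x) = U \<alpha> \<beta> x" if "x \<in> {-1..1}" for x
    using that by (simp add: U_def)
  have pos: "U \<alpha> \<beta> x > 0" if x: "x \<in> {-1<..<1}" for x
  proof -
    \<comment> \<open>The distance from x to the flat piece treats both wings at once; positivity is
      then the strict growth of \<open>cosh\<close> together with m r < t.\<close>
    define r where "r = max 0 (\<bar>x\<bar> - \<alpha>)"
    have "profile \<alpha> m \<beta> x = \<beta> - height (m * r)"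
      using assms by (cases "x \<ge> 0") (auto simp: profile_def hinge_def r_def height_def max_def)
    moreover have "m * r < t"
      using m1 mpos x assms unfolding r_def by (auto simp flip: m1 simp: max_def)
    then have "height (m * r) < height t"
      using mpos assms cosh_real_nonneg_less_iff[of "m * r" t]
      by (simp add: height_def r_def)
    ultimately show ?thesis using x eq[of x] by (simp add: \<beta>_def)
  qed
  have "U \<alpha> \<beta> \<in> extensional {-1..1}" by (simp add: U_def)
  then show ?thesis
    unfolding positive_even_solution_def solution_def
    using C2 C1 bd ode even pos by (auto simp: lam_def \<beta>_def)
qed

lemma U_at_0: "0 < \<alpha> \<Longrightarrow> U \<alpha> \<beta> 0 = \<beta>"
  by (simp add: U_def)

text \<open>The value \<open>height t\<close> is attained at 0. It is an upper bound because both
  hinges are nonpositive, and positivity of the solution removes the absolute value.\<close>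

lemma sup_norm_U:
  assumes "0 < \<alpha>" "\<alpha> < 1" "t > 0"
  shows "sup_norm (U \<alpha> (height t)) = height t"
  unfolding sup_norm_def
proof (rule cSup_eq_maximum)
  show "height t \<in> (\<lambda>x. \<bar>U \<alpha> (height t) x\<bar>) ` {-1..1}"
    using assms height_pos[of t] by (intro image_eqI[of _ _ 0]) (auto simp: U_at_0)
  fix y assume "y \<in> (\<lambda>x. \<bar>U \<alpha> (height t) x\<bar>) ` {-1..1}"
  then obtain x where x: "x \<in> {-1..1}" "y = \<bar>U \<alpha> (height t) x\<bar>" by auto
  have sol: "positive_even_solution \<alpha> (\<Lambda> \<alpha> (height t)) (U \<alpha> (height t))"
    using assms by (rule U_solution)
  have "U \<alpha> (height t) x \<ge> 0"
  proof (cases "x \<in> {-1<..<1}")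
    case True
    then show ?thesis using sol by (auto simp: positive_even_solution_def intro: less_imp_le)
  next
    case False
    then have "x = -1 \<or> x = 1" using x by auto
    then show ?thesis using sol by (auto simp: positive_even_solution_def solution_def)
  qed
  moreover have "U \<alpha> (height t) x \<le> height t"
    using U_eq_profile[OF assms x(1)] hinge_le_0 by (smt (verit) profile_def)
  ultimately show "y \<le> height t" using x by simp
qed

section \<open>Uniqueness: every positive even solution is some \<open>U\<close>\<close>

text \<open>The notion of solution supplies three derivatives: a C1 witness on the closed interval,
  a C2 witness off the corners, and \<open>deriv\<close>. They agree at interior points off the
  corners, so the C1 witness p can carry the equation while staying continuous across
  \<plusminus>\<alpha>.\<close>

lemma solution_first_order:
  assumes "solution \<alpha> lam u"
  obtains p where "continuous_on {-1..1} p"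
    "\<And>x. x \<in> {-1..1} \<Longrightarrow> (u has_real_derivative p x) (at x within {-1..1})"
    "\<And>x. x \<in> {-1<..<1} - {-\<alpha>, \<alpha>} \<Longrightarrow>
        (p has_real_derivative - lam * h x \<alpha> * exp (u x)) (at x)"
proof -
  let ?S = "{-1..1} - {-\<alpha>, \<alpha>}" and ?T = "{-1<..<1} - {-\<alpha>, \<alpha>}"
  obtain p where p: "continuous_on {-1..1} p"
      "\<And>x. x \<in> {-1..1} \<Longrightarrow> (u has_real_derivative p x) (at x within {-1..1})"
    using assms unfolding solution_def C1_on_def by blast
  obtain q q' where q: "\<And>x. x \<in> ?S \<Longrightarrow> (u has_real_derivative q x) (at x within ?S)"
      "\<And>x. x \<in> ?S \<Longrightarrow> (q has_real_derivative q' x) (at x within ?S)"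
    using assms unfolding solution_def C2_on_def C1_on_def by blast
  have opn: "open ?T" by (simp add: open_Diff)
  have at: "at x within ?S = at x" if "x \<in> ?T" for x
    using that opn by (intro at_within_interior interiorI[of ?T]) auto
  have up: "(u has_real_derivative p x) (at x)" if "x \<in> ?T" for x
    using p(2)[of x] that by (simp add: at_within_Icc_at)
  have uq: "(u has_real_derivative q x) (at x)" if "x \<in> ?T" for x
    using q(1)[of x] at[OF that] that by auto
  have pq: "p x = q x" if "x \<in> ?T" for x
    using DERIV_unique[OF up uq] that by blast
  have du: "deriv u x = q x" if "x \<in> ?T" for x
    using DERIV_imp_deriv uq that by blast
  show thesis
  proof (rule that[OF p])
    fix x assume x: "x \<in> ?T"
    have q': "(q has_real_derivative q' x) (at x)"
      using q(2)[of x] at[OF x] x by auto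
    have "(deriv u has_real_derivative q' x) (at x)"
      using du by (intro has_field_derivative_transform_within_open[OF q' opn x]) auto
    then have "q' x = - lam * h x \<alpha> * exp (u x)"
      using assms x by (auto simp: solution_def dest!: DERIV_imp_deriv bspec[of _ _ x])
    moreover have "(p has_real_derivative q' x) (at x)"
      using pq by (intro has_field_derivative_transform_within_open[OF q' opn x]) auto
    ultimately show "(p has_real_derivative - lam * h x \<alpha> * exp (u x)) (at x)" by simp
  qed auto
qed

text \<open>For s = \<plusminus>m the combination z + s y satisfies a first-order linear equation
  with rate s, hence is an exponential. Subtracting the two cases eliminates z and leaves
  \<open>cosh\<close>.\<close>

lemma linear_ivp_cosh:
  fixes y z :: "real \<Rightarrow> real"
  assumes "m \<noteq> 0" "a \<le> x" "x \<le> b" "continuous_on {a..b} y" "continuous_on {a..b} z"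
    and y: "\<And>x. a < x \<Longrightarrow> x < b \<Longrightarrow> (y has_real_derivative z x) (at x)"
    and z: "\<And>x. a < x \<Longrightarrow> x < b \<Longrightarrow> (z has_real_derivative m\<^sup>2 * y x) (at x)"
    and "z a = 0"
  shows "y x = y a * cosh (m * (x - a))"
proof -
  have const: "z x + s * y x = s * y a * exp (s * (x - a))" if "s\<^sup>2 = m\<^sup>2" for s
  \<comment> \<open>The constancy criterion requires a < b; on a degenerate interval x = a and the
    claim is the initial condition.\<close>
  proof (cases "a = b")
    case False
    let ?f = "\<lambda>x. (z x + s * y x) * exp (- s * (x - a))"
    have "?f x = ?f a"
    proof (rule DERIV_isconst2[of a b ?f x])
      show "a < b" "a \<le> x" "x \<le> b" using False assms by auto
      show "continuous_on {a..b} ?f" using assms by (intro continuous_intros)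
      show "(?f has_real_derivative 0) (at x)" if "a < x" "x < b" for x
        using y[OF that] z[OF that, folded \<open>s\<^sup>2 = m\<^sup>2\<close>]
        by (auto intro!: derivative_eq_intros simp: power2_eq_square algebra_simps)
    qed
    then have "?f x * exp (s * (x - a)) = s * y a * exp (s * (x - a))" using assms by simp
    then show ?thesis by (simp add: mult.assoc flip: exp_add)
  qed (use assms in auto)
  have "z x + m * y x = m * y a * exp (m * (x - a))"
    by (rule const) simp
  moreover have "z x - m * y x = - m * y a * exp (- (m * (x - a)))"
    using const[of "- m"] by simp
  ultimately have "m * (2 * y x) = m * (y a * (exp (m * (x - a)) + exp (- (m * (x - a)))))"
    by (simp add: algebra_simps)
  then show ?thesis using \<open>m \<noteq> 0\<close> by (simp add: cosh_field_def)
qed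

text \<open>Energy conservation turns the nonlinear equation for \<open>u\<close> into a linear one for
  \<open>exp (- u / 2)\<close>, so no general uniqueness theorem for initial value problems is needed.\<close>

lemma liouville_ivp:
  fixes u p :: "real \<Rightarrow> real"
  assumes "lam > 0" "a \<le> x" "x \<le> b" "continuous_on {a..b} u" "continuous_on {a..b} p"
    and u: "\<And>x. a < x \<Longrightarrow> x < b \<Longrightarrow> (u has_real_derivative p x) (at x)"
    and p: "\<And>x. a < x \<Longrightarrow> x < b \<Longrightarrow> (p has_real_derivative - lam * exp (u x)) (at x)"
    and "p a = 0"
  shows "u x = u a - height (sqrt (lam * exp (u a) / 2) * (x - a))"
proof (cases "a = b")
  case False
  have energy: "(p x)\<^sup>2 / 2 + lam * exp (u x) = lam * exp (u a)" if x: "a \<le> x" "x \<le> b" for x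
  proof -
    let ?f = "\<lambda>x. (p x)\<^sup>2 / 2 + lam * exp (u x)"
    have "?f x = ?f a"
    proof (rule DERIV_isconst2[of a b ?f x])
      show "a < b" "a \<le> x" "x \<le> b" using False x by auto
      show "continuous_on {a..b} ?f" using assms by (intro continuous_intros) auto
      show "(?f has_real_derivative 0) (at x)" if "a < x" "x < b" for x
        using u[OF that] p[OF that] by (auto intro!: derivative_eq_intros)
    qed
    then show ?thesis using \<open>p a = 0\<close> by simp
  qed
  \<comment> \<open>The square of m is half the conserved energy. Differentiating exp(-u/2) twice
    gives it back with factor p^2/4 + lam exp(u)/2, which is also half the energy.\<close>
  define m where "m = sqrt (lam * exp (u a) / 2)"
  have m: "m > 0" "m\<^sup>2 = lam * exp (u a) / 2" using \<open>lam > 0\<close> by (auto simp: m_def)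
  let ?y = "\<lambda>x. exp (- u x / 2)" and ?z = "\<lambda>x. - p x / 2 * exp (- u x / 2)"
  have y: "?y x = ?y a * cosh (m * (x - a))"
  proof (rule linear_ivp_cosh)
    fix x assume x: "a < x" "x < b"
    show "(?y has_real_derivative ?z x) (at x)"
      using u[OF x] by (auto intro!: derivative_eq_intros)
    have "m\<^sup>2 = (p x)\<^sup>2 / 4 + lam * exp (u x) / 2"
      using energy[of x] x m by simp
    moreover have "(?z has_real_derivative ((p x)\<^sup>2 / 4 + lam * exp (u x) / 2) * ?y x) (at x)"
      using u[OF x] p[OF x]
      by (auto intro!: derivative_eq_intros simp: power2_eq_square field_simps)
    ultimately show "(?z has_real_derivative m\<^sup>2 * ?y x) (at x)" by simp
  qed (use assms m in \<open>auto intro!: continuous_intros\<close>)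
  have "- u x / 2 = ln (?y x)" by simp
  also have "\<dots> = - u a / 2 + ln (cosh (m * (x - a)))"
    unfolding y by (subst ln_mult) auto
  finally show ?thesis by (simp add: height_def m_def)
qed (use assms in \<open>auto simp: height_def\<close>)

text \<open>Symmetry forces zero slope at \<alpha>, the Liouville problem started there determines
  the right wing, evenness gives the left one, and u(1) = 0 ties the maximum to the rate m.\<close>

lemma positive_even_solution_unique:
  assumes \<alpha>: "0 < \<alpha>" "\<alpha> < 1" and lam: "lam > 0" and sol: "positive_even_solution \<alpha> lam u"
  obtains t where "t > 0" "lam = \<Lambda> \<alpha> (height t)" "u = U \<alpha> (height t)"
proof -
  have s: "solution \<alpha> lam u" and pos: "u 0 > 0" and u1: "u 1 = 0"
    and even: "\<And>x. x \<in> {-1..1} \<Longrightarrow> u (-x) = u x" and ext: "u \<in> extensional {-1..1}"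
    using sol by (auto simp: positive_even_solution_def solution_def)
  obtain p where pc: "continuous_on {-1..1} p"
    and up: "\<And>x. x \<in> {-1..1} \<Longrightarrow> (u has_real_derivative p x) (at x within {-1..1})"
    and pd: "\<And>x. x \<in> {-1<..<1} - {-\<alpha>, \<alpha>} \<Longrightarrow>
        (p has_real_derivative - lam * h x \<alpha> * exp (u x)) (at x)"
    using solution_first_order[OF s] by blast
  have uc: "continuous_on {-1..1} u"
    using up by (meson DERIV_continuous continuous_on_eq_continuous_within)
  have ud: "(u has_real_derivative p x) (at x)" if "x \<in> {-1<..<1}" for x
    using up[of x] that by (simp add: at_within_Icc_at)
  have sub: "continuous_on {-\<alpha>..\<alpha>} u" "continuous_on {-\<alpha>..\<alpha>} p"
      "continuous_on {\<alpha>..1} u" "continuous_on {\<alpha>..1} p"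
    using \<alpha> uc pc by (auto intro: continuous_on_subset[OF uc] continuous_on_subset[OF pc])
  have pconst: "p x = p (-\<alpha>)" if "x \<in> {-\<alpha>..\<alpha>}" for x
  proof (rule DERIV_isconst2[of "-\<alpha>" \<alpha> p x])
    show "(p has_real_derivative 0) (at x)" if "-\<alpha> < x" "x < \<alpha>" for x
    proof -
      have "\<bar>x\<bar> < \<alpha>" "x \<in> {-1<..<1} - {-\<alpha>, \<alpha>}" using that \<alpha> by auto
      then show ?thesis using pd[of x] by (simp add: h_def)
    qed
  qed (use that \<alpha> sub in auto)
  \<comment> \<open>Removing the linear part shows u to be affine on [-\<alpha>, \<alpha>]; since u
    takes equal values at \<plusminus>\<alpha>, the slope \<open>p (-\<alpha>)\<close> is
    zero.\<close>
  let ?g = "\<lambda>x. u x - p (-\<alpha>) * x"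
  have gconst: "?g x = ?g (-\<alpha>)" if "x \<in> {-\<alpha>..\<alpha>}" for x
  proof (rule DERIV_isconst2[of "-\<alpha>" \<alpha> ?g x])
    show "(?g has_real_derivative 0) (at x)" if "-\<alpha> < x" "x < \<alpha>" for x
      using ud[of x] pconst[of x] that \<alpha> by (auto intro!: derivative_eq_intros)
  qed (use that \<alpha> sub in \<open>auto intro!: continuous_intros\<close>)
  have "p (-\<alpha>) = 0" using gconst[of \<alpha>] even[of \<alpha>] \<alpha> by simp
  then have flat: "u x = u 0" if "x \<in> {-\<alpha>..\<alpha>}" for x
    using gconst[of x] gconst[of 0] that \<alpha> by simp
  have p0: "p \<alpha> = 0" using pconst[of \<alpha>] \<open>p (-\<alpha>) = 0\<close> \<alpha> by simp
  define m where "m = sqrt (lam * exp (u 0) / 2)"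
  have m: "m > 0" "m\<^sup>2 = lam * exp (u 0) / 2" using lam by (auto simp: m_def)
  have wing: "u x = u 0 - height (m * (x - \<alpha>))" if "x \<in> {\<alpha>..1}" for x
  proof -
    have "u x = u \<alpha> - height (sqrt (lam * exp (u \<alpha>) / 2) * (x - \<alpha>))"
    proof (rule liouville_ivp)
      fix x assume x: "\<alpha> < x" "x < 1"
      show "(u has_real_derivative p x) (at x)" using ud x \<alpha> by auto
      show "(p has_real_derivative - lam * exp (u x)) (at x)"
        using pd[of x] x \<alpha> by (auto simp: h_def)
    qed (use that lam sub p0 in auto)
    then show ?thesis using flat[of \<alpha>] \<alpha> by (simp add: m_def)
  qed
  \<comment> \<open>This is the argument of \<open>height\<close> on the wing at x = 1, so the
    boundary condition reads u(0) = \<open>height t\<close>.\<close>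
  define t where "t = m * (1 - \<alpha>)"
  have t: "t > 0" using m \<alpha> by (simp add: t_def)
  have mt: "m = t / (1 - \<alpha>)" using \<alpha> by (simp add: t_def)
  have u0: "u 0 = height t" using wing[of 1] \<alpha> u1 by (simp add: t_def)
  have "lam = 2 * m\<^sup>2 * exp (- u 0)" by (simp add: m exp_minus)
  then have L: "lam = \<Lambda> \<alpha> (height t)" using \<alpha> t by (simp add: Lambda_height' mt u0)
  have "u x = U \<alpha> (height t) x" if x: "x \<in> {-1..1}" for x
  proof -
    have "u x = u \<bar>x\<bar>" using even[OF x] by (simp add: abs_if)
    also have "\<dots> = profile \<alpha> m (height t) x"
    proof (cases "\<bar>x\<bar> \<le> \<alpha>")
      case True
      then show ?thesis using flat[of "\<bar>x\<bar>"] u0 \<alpha> by (simp add: profile_def hinge_nonpos)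
    next
      case False
      then show ?thesis using wing[of "\<bar>x\<bar>"] x u0 \<alpha>
        by (auto simp: profile_def hinge_def height_def max_def abs_if split: if_splits)
    qed
    finally show ?thesis using U_eq_profile[OF \<alpha> t x] mt by simp
  qed
  then have "u = U \<alpha> (height t)"
    using ext by (intro extensionalityI[OF ext]) (auto simp: U_def)
  with t L show thesis by (rule that)
qed

lemma positive_even_solutions_eq:
  assumes "0 < \<alpha>" "\<alpha> < 1" "lam > 0"
  shows "{u. positive_even_solution \<alpha> lam u}
           = (\<lambda>t. U \<alpha> (height t)) ` {t. t > 0 \<and> lam = \<Lambda> \<alpha> (height t)}"
  using positive_even_solution_unique[OF assms] U_solution assms by blast

text \<open>The value at 0 recovers \<open>height t\<close>, hence t. Counting solutions thus
  becomes counting parameters.\<close>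

lemma inj_on_U_height: "0 < \<alpha> \<Longrightarrow> inj_on (\<lambda>t. U \<alpha> (height t)) {0<..}"
  by (rule inj_onI) (metis U_at_0 height_inject greaterThan_iff)

section \<open>The unimodal function t / cosh t\<close>

lemma x_tanh_strict_mono:
  fixes x y :: real
  assumes "0 \<le> x" "x < y"
  shows "x * tanh x < y * tanh y"
proof -
  have "x * tanh x \<le> x * tanh y" using assms by (intro mult_left_mono) auto
  also have "\<dots> < y * tanh y" using assms by (intro mult_strict_right_mono) auto
  finally show ?thesis .
qed

text \<open>Intermediate value theorem: t tanh t is 0 at 0 and tends to infinity, since tanh t tends
  to 1.\<close>

lemma x_tanh_eq_1:
  obtains s :: real where "s > 0" "s * tanh s = 1"
proof -
  have "filterlim (\<lambda>t::real. t * tanh t) at_top at_top"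
    by (rule filterlim_at_top_mult_tendsto_pos[OF tanh_real_at_top]) (auto intro: filterlim_ident)
  then have "\<forall>\<^sub>F t::real in at_top. t * tanh t \<ge> 1"
    by (simp add: filterlim_at_top)
  then have "\<forall>\<^sub>F t::real in at_top. t * tanh t \<ge> 1 \<and> t > 0"
    using eventually_gt_at_top by (rule eventually_conj)
  then obtain T :: real where "T * tanh T \<ge> 1" "T > 0"
    using eventually_happens'[OF trivial_limit_at_top_linorder] by fast
  moreover have "continuous_on {0..T} (\<lambda>t. t * tanh t)"
    by (auto intro!: continuous_intros)
  ultimately obtain s :: real where s: "0 \<le> s" "s * tanh s = 1"
    using IVT'[of "\<lambda>t. t * tanh t" 0 1 T] by auto
  then have "s \<noteq> 0" by auto
  with s show thesis by (intro that) auto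
qed

lemma x_div_cosh_deriv:
  "((\<lambda>t. t / cosh t) has_real_derivative (1 - t * tanh t) / cosh t) (at t)"
  by (auto intro!: derivative_eq_intros simp: tanh_def field_simps power2_eq_square)

lemma x_div_cosh_continuous: "continuous_on S (\<lambda>t::real. t / cosh t)"
  by (auto intro!: continuous_intros)

context
  fixes s :: real
  \<comment> \<open>By \<open>x_div_cosh_deriv\<close> and the monotonicity of t tanh t, this s is
    where the derivative of t / cosh t changes sign from positive to negative.\<close>
  assumes s: "s > 0" "s * tanh s = 1"
begin

lemma x_div_cosh_increasing:
  assumes "0 \<le> x" "x < y" "y \<le> s"
  shows "x / cosh x < y / cosh y"
proof (rule DERIV_pos_imp_increasing_open[OF assms(2)])
  fix t assume "x < t" "t < y"
  then have "t * tanh t < 1" using x_tanh_strict_mono[of t s] assms s by simp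
  then show "\<exists>d. ((\<lambda>t. t / cosh t) has_real_derivative d) (at t) \<and> d > 0"
    using x_div_cosh_deriv by (intro exI conjI) auto
qed (rule x_div_cosh_continuous)

lemma x_div_cosh_decreasing:
  assumes "s \<le> x" "x < y"
  shows "y / cosh y < x / cosh x"
proof (rule DERIV_neg_imp_decreasing_open[OF assms(2)])
  fix t assume "x < t" "t < y"
  then have "t * tanh t > 1" using x_tanh_strict_mono[of s t] assms s by simp
  then show "\<exists>d. ((\<lambda>t. t / cosh t) has_real_derivative d) (at t) \<and> d < 0"
    using x_div_cosh_deriv by (intro exI conjI) (auto simp: divide_neg_pos)
qed (rule x_div_cosh_continuous)

lemma x_div_cosh_less_max: "0 \<le> x \<Longrightarrow> x \<noteq> s \<Longrightarrow> x / cosh x < s / cosh s"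
  using x_div_cosh_increasing[of x s] x_div_cosh_decreasing[of s x] by (cases "x < s") auto

text \<open>The quotient rises from 0 to its maximum at s and then decays to 0, so a level strictly
  in between is taken once on each side of s.\<close>

lemma x_div_cosh_two_preimages:
  assumes "0 < c" "c < s / cosh s"
  shows "card {t. t > 0 \<and> t / cosh t = c} = 2"
proof -
  let ?g = "\<lambda>t::real. t / cosh t"
  obtain t1 where t1: "0 \<le> t1" "t1 \<le> s" "?g t1 = c"
    using IVT'[of ?g 0 c s] assms s x_div_cosh_continuous by auto
  \<comment> \<open>Since cosh t \<ge> exp(t)/2, the quotient is at most 2 t / exp t, which supplies
    a point T beyond s where it has dropped to c or below.\<close>
  have "((\<lambda>t::real. 2 * (t ^ 1 / exp t)) \<longlongrightarrow> 2 * 0) at_top"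
    by (intro tendsto_mult tendsto_const tendsto_power_div_exp_0)
  then have "\<forall>\<^sub>F t::real in at_top. 2 * (t / exp t) < c"
    using assms(1) by (intro order_tendstoD) auto
  then have "\<forall>\<^sub>F t::real in at_top. 2 * (t / exp t) < c \<and> t > s"
    using eventually_gt_at_top by (rule eventually_conj)
  then obtain T where T: "2 * (T / exp T) < c" "T > s"
    using eventually_happens'[OF trivial_limit_at_top_linorder] by fast
  have "?g T \<le> T / (exp T / 2)"
    using T s by (intro divide_left_mono) (auto simp: cosh_field_def intro!: mult_pos_pos add_pos_pos)
  then have "?g T \<le> c" using T(1) by (simp add: mult.commute)
  then obtain t2 where t2: "s \<le> t2" "?g t2 = c"
    using IVT2'[of ?g T c s] assms T s x_div_cosh_continuous by auto
  have ne: "t1 > 0" "t1 < s" "s < t2"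
    using t1 t2 assms by (auto simp: order.order_iff_strict)
  have "{t. t > 0 \<and> ?g t = c} = {t1, t2}"
  proof (intro set_eqI iffI)
    fix t assume "t \<in> {t. t > 0 \<and> ?g t = c}"
    then have t: "t > 0" "?g t = c" by auto
    show "t \<in> {t1, t2}"
    proof (cases "t \<le> s")
      case True
      then have "t = t1"
        using x_div_cosh_increasing[of t t1] x_div_cosh_increasing[of t1 t] t t1 ne
        by (cases t t1 rule: linorder_cases) auto
      then show ?thesis by simp
    next
      case False
      then have "t = t2"
        using x_div_cosh_decreasing[of t t2] x_div_cosh_decreasing[of t2 t] t t2 ne
        by (cases t t2 rule: linorder_cases) auto
      then show ?thesis by simp
    qed
  qed (use t1 t2 ne s in auto)
  then show ?thesis using ne by simp
qed

end

section \<open>Counting solutions for a given parameter\<close>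

lemma sqrt_scale_eq_iff:
  fixes g K lam :: real
  assumes "g \<ge> 0" "K > 0" "lam > 0"
  shows "lam = K * g\<^sup>2 \<longleftrightarrow> g = sqrt (lam / K)"
proof
  assume "lam = K * g\<^sup>2"
  then show "g = sqrt (lam / K)" using assms by simp
next
  assume "g = sqrt (lam / K)"
  then show "lam = K * g\<^sup>2" using assms by simp
qed

theorem proposition1p2:
  fixes \<alpha> :: real
  assumes "0 < \<alpha>" and "\<alpha> < 1"
  shows
    "(\<forall>\<beta>>0.
        (\<exists>!(lam, u). lam > 0 \<and> positive_even_solution \<alpha> lam u \<and> sup_norm u = \<beta>) \<and>
        \<Lambda> \<alpha> \<beta> > 0 \<and> positive_even_solution \<alpha> (\<Lambda> \<alpha> \<beta>) (U \<alpha> \<beta>) \<and> sup_norm (U \<alpha> \<beta>) = \<beta>) \<and>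
     (\<exists>!\<beta>1. turning_point \<beta>1) \<and>
     (\<forall>\<beta>1 lam1. turning_point \<beta>1 \<longrightarrow> lam1 = \<Lambda> \<alpha> \<beta>1 \<longrightarrow>
        (\<forall>lam. 0 < lam \<and> lam < lam1 \<longrightarrow> card {u. positive_even_solution \<alpha> lam u} = 2) \<and>
        (\<exists>!u. positive_even_solution \<alpha> lam1 u) \<and>
        (\<forall>lam>lam1. \<not> (\<exists>u. positive_even_solution \<alpha> lam u)))"
proof (intro conjI)
  show "\<forall>\<beta>>0.
        (\<exists>!(lam, u). lam > 0 \<and> positive_even_solution \<alpha> lam u \<and> sup_norm u = \<beta>) \<and>
        \<Lambda> \<alpha> \<beta> > 0 \<and> positive_even_solution \<alpha> (\<Lambda> \<alpha> \<beta>) (U \<alpha> \<beta>) \<and> sup_norm (U \<alpha> \<beta>) = \<beta>"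
  proof (intro allI impI)
    fix \<beta> :: real assume "\<beta> > 0"
    then obtain t where t: "t > 0" "\<beta> = height t" by (rule height_surj)
    have ex: "\<Lambda> \<alpha> \<beta> > 0" "positive_even_solution \<alpha> (\<Lambda> \<alpha> \<beta>) (U \<alpha> \<beta>)" "sup_norm (U \<alpha> \<beta>) = \<beta>"
      using assms t U_solution by (auto simp: Lambda_height sup_norm_U)
    \<comment> \<open>Any such u is \<open>U\<close> at some \<open>height\<close>, and its norm is
      that height; prescribing the norm therefore fixes both members of the pair.\<close>
    have un: "(lam, u) = (\<Lambda> \<alpha> \<beta>, U \<alpha> \<beta>)"
      if "lam > 0" "positive_even_solution \<alpha> lam u" "sup_norm u = \<beta>" for lam u
      using positive_even_solution_unique[OF assms that(1,2)] sup_norm_U[OF assms] that(3) by metis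
    have "\<exists>!(lam, u). lam > 0 \<and> positive_even_solution \<alpha> lam u \<and> sup_norm u = \<beta>"
    proof (rule ex1I)
      show "case (\<Lambda> \<alpha> \<beta>, U \<alpha> \<beta>) of (lam, u) \<Rightarrow>
          lam > 0 \<and> positive_even_solution \<alpha> lam u \<and> sup_norm u = \<beta>"
        using ex by simp
    qed (use un in blast)
    with ex show "(\<exists>!(lam, u). lam > 0 \<and> positive_even_solution \<alpha> lam u \<and> sup_norm u = \<beta>) \<and>
        \<Lambda> \<alpha> \<beta> > 0 \<and> positive_even_solution \<alpha> (\<Lambda> \<alpha> \<beta>) (U \<alpha> \<beta>) \<and> sup_norm (U \<alpha> \<beta>) = \<beta>"
      by blast
  qed
  obtain s :: real where s: "s > 0" "s * tanh s = 1" by (rule x_tanh_eq_1)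
  have turning: "turning_point \<beta> \<longleftrightarrow> \<beta> = height s" for \<beta>
  proof
    assume tp: "turning_point \<beta>"
    then have "\<beta> > 0" by (simp add: turning_point_def)
    then obtain t where t: "t > 0" "\<beta> = height t" by (rule height_surj)
    then have "t * tanh t = 1" using tp turning_point_height by simp
    then have "t = s"
      using x_tanh_strict_mono[of s t] x_tanh_strict_mono[of t s] s t
      by (cases t s rule: linorder_cases) auto
    then show "\<beta> = height s" using t by simp
  next
    assume "\<beta> = height s"
    then show "turning_point \<beta>" using s turning_point_height by simp
  qed
  then show "\<exists>!\<beta>1. turning_point \<beta>1" by simp
  define K where "K = 2 / (1 - \<alpha>)\<^sup>2"
  have K: "K > 0" using assms by (simp add: K_def)
  have L: "\<Lambda> \<alpha> (height t) = K * (t / cosh t)\<^sup>2" if "t > 0" for t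
    using that by (simp add: Lambda_height K_def)
  \<comment> \<open>For fixed lam > 0 the solutions correspond to the level set of t / cosh t at
    \<open>sqrt (lam / K)\<close>; comparing lam with \<open>lam1\<close> amounts to comparing this
    level with the maximum.\<close>
  have sols: "{u. positive_even_solution \<alpha> lam u}
      = (\<lambda>t. U \<alpha> (height t)) ` {t. t > 0 \<and> t / cosh t = sqrt (lam / K)}" if "lam > 0" for lam
  proof -
    have "lam = \<Lambda> \<alpha> (height t) \<longleftrightarrow> t / cosh t = sqrt (lam / K)" if "t > 0" for t
      unfolding L[OF that] using that \<open>lam > 0\<close> K by (intro sqrt_scale_eq_iff) auto
    then have "{t. t > 0 \<and> lam = \<Lambda> \<alpha> (height t)} = {t. t > 0 \<and> t / cosh t = sqrt (lam / K)}"
      by blast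
    then show ?thesis using positive_even_solutions_eq[OF assms that] by simp
  qed
  have top: "\<Lambda> \<alpha> (height s) > 0" "sqrt (\<Lambda> \<alpha> (height s) / K) = s / cosh s"
    using s K by (auto simp: L)
  show "\<forall>\<beta>1 lam1. turning_point \<beta>1 \<longrightarrow> lam1 = \<Lambda> \<alpha> \<beta>1 \<longrightarrow>
        (\<forall>lam. 0 < lam \<and> lam < lam1 \<longrightarrow> card {u. positive_even_solution \<alpha> lam u} = 2) \<and>
        (\<exists>!u. positive_even_solution \<alpha> lam1 u) \<and>
        (\<forall>lam>lam1. \<not> (\<exists>u. positive_even_solution \<alpha> lam u))"
    unfolding turning
  proof (intro allI impI conjI)
    fix \<beta>1 lam1 lam assume "\<beta>1 = height s" "lam1 = \<Lambda> \<alpha> \<beta>1" and lam: "0 < lam \<and> lam < lam1"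
    then have "sqrt (lam / K) < sqrt (\<Lambda> \<alpha> (height s) / K)"
      using K by (simp add: divide_strict_right_mono)
    then have "card {t. t > 0 \<and> t / cosh t = sqrt (lam / K)} = 2"
      using x_div_cosh_two_preimages[OF s] lam K top by simp
    moreover have "inj_on (\<lambda>t. U \<alpha> (height t)) {t. t > 0 \<and> t / cosh t = sqrt (lam / K)}"
      by (rule inj_on_subset[OF inj_on_U_height[OF assms(1)]]) auto
    ultimately show "card {u. positive_even_solution \<alpha> lam u} = 2"
      using sols lam by (simp add: card_image)
  next
    fix \<beta>1 lam1 assume "\<beta>1 = height s" "lam1 = \<Lambda> \<alpha> \<beta>1"
    \<comment> \<open>The maximum is strict, so its level set is the single point s.\<close>
    moreover have "{t. t > 0 \<and> t / cosh t = s / cosh s} = {s}"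
      using x_div_cosh_less_max[OF s] s by (auto intro: less_imp_le dest: less_imp_neq)
    ultimately have "{u. positive_even_solution \<alpha> lam1 u} = {U \<alpha> (height s)}"
      using sols[of lam1] top by simp
    then have "positive_even_solution \<alpha> lam1 u \<longleftrightarrow> u = U \<alpha> (height s)" for u
      by (simp add: set_eq_iff)
    then show "\<exists>!u. positive_even_solution \<alpha> lam1 u" by simp
  next
    fix \<beta>1 lam1 lam assume "\<beta>1 = height s" "lam1 = \<Lambda> \<alpha> \<beta>1" and lam: "lam > lam1"
    then have "s / cosh s < sqrt (lam / K)" and "lam > 0"
      using K top by (auto simp: divide_strict_right_mono simp flip: top(2))
    moreover have "t / cosh t \<le> s / cosh s" if "t > 0" for t
      using x_div_cosh_less_max[OF s, of t] that by (cases "t = s") auto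
    ultimately have "{t. t > 0 \<and> t / cosh t = sqrt (lam / K)} = {}"
      by force
    then show "\<not> (\<exists>u. positive_even_solution \<alpha> lam u)"
      using sols[OF \<open>lam > 0\<close>] by auto
  qed
qed

end
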